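(* Consider the second order finite difference scheme in two dimensions: for $i,j=1,\dots,N$, $$\begin{aligned}&\mathcal M_{i,j}g_{i,j}^{n+1}+\Delta t\frac{u_{i-1,j}g_{i-1,j}^{n+1}-u_{i+1,j}g_{i+1,j}^{n+1}}{2h}+\Delta t\frac{v_{i,j-1}g_{i,j-1}^{n+1}-v_{i,j+1}g_{i,j+1}^{n+1}}{2h}\\&+\Delta t\frac{-D(\mathcal M_{i-1,j}+\mathcal M_{i,j})g_{i-1,j}^{n+1}+D(\mathcal M_{i-1,j}+2\mathcal M_{i,j}+\mathcal M_{i+1,j})g_{i,j}^{n+1}-D(\mathcal M_{i,j}+\mathcal M_{i+1,j})g_{i+1,j}^{n+1}}{2h^2}\\&+\Delta t\frac{-D(\mathcal M_{i,j-1}+\mathcal M_{i,j})g_{i,j-1}^{n+1}+D(\mathcal M_{i,j-1}+2\mathcal M_{i,j}+\mathcal M_{i,j+1})g_{i,j}^{n+1}-D(\mathcal M_{i,j}+\mathcal M_{i,j+1})g_{i,j+1}^{n+1}}{2h^2}=\mathcal M_{i,j}g_{i,j}^n.\end{aligned}$$ Suppose that for all $i,j$ $$h|u_{i,j}|\ \text{ and }\ h|v_{i,j}|\ \text{ are both }\le D\min\{\mathcal M_{i-1,j},\mathcal M_{i+1,j},\mathcal M_{i,j},\mathcal M_{i,j-1},\mathcal M_{i,j+1}\},$$ and $$\mathcal M_{i,j}+\Delta t\,\frac{u_{i-1,j}-u_{i+1,j}}{2h}+\Delta t\,\frac{v_{i,j-1}-v_{i,j+1}}{2h}>0 .$$ Then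 the coefficient matrix for the unknown vector $g^{n+1}$ is an M-matrix and thus is monotone. In particular, if the velocity field is discrete divergence free, i.e. $$\frac{u_{i-1,j}-u_{i+1,j}}{2h}+\frac{v_{i,j-1}-v_{i,j+1}}{2h}=0\quad\forall i,j,$$ then the coefficient matrix is monotone under the first (mesh) constraint alone.
   Context: $\Omega=[-L,L]^2$ with uniform grid points $(x_i,y_j)$, $-L=x_1<\dots<x_N=L$, $-L=y_1<\dots<y_N=L$, of spacing $h$ ($N\ge3$); $D>0$ is a constant, $\Delta t>0$. $\mathcal M_{i,j}=\mathcal M(x_i,y_j)>0$ are point values of a given positive function, and $(u_{i,j},v_{i,j})$ are point values of a given velocity field $\vec u=(u,v)$ satisfying the boundary condition $\vec u\cdot\vec n=0$, i.e. $u_{1,j}=u_{N,j}=0$ and $v_{i,1}=v_{i,N}=0$. Ghost values: $g$ and $\mathcal M$ are extended evenly, $g_{0,j}:=g_{2,j}$, $g_{N+1,j}:=g_{N-1,j}$, $g_{i,0}:=g_{i,2}$, $g_{i,N+1}:=g_{i,N-1}$ and likewise for $\mathcal M$; the normal velocity is extended oddly, $u_{0,j}:=-u_{2,j}$, $u_{N+1,j}:=-u_{N-1,j}$, $v_{i,0}:=-v_{i,2}$, $v_{i,N+1}:=-v_{i,N-1}$. These are substituted so that the scheme is an $N^2\times N^2$ linear system. All constraints are for $1\le i,j\le N$. A square matrix $A$ is monotone if it is invertible and all entries of $A^{-1}$ are nonnegative. A square matrix $A$ is an M-matrix if $A=sI-B$ with $B\ge0$ entrywise and $s$ greater than the spectral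 radius of $B$. *)

theory Defs
  imports "Jordan_Normal_Form.Matrix" "Jordan_Normal_Form.Spectral_Radius"
begin

definition nonneg_mat :: "real mat \<Rightarrow> bool" where
  "nonneg_mat A \<longleftrightarrow> (\<forall>i<dim_row A. \<forall>j<dim_col A. 0 \<le> A $$ (i, j))"

text \<open>The two-sided inverse is unique, so the witness below is the inverse of \<open>A\<close>;
  the two products being identity matrices forces its dimensions.\<close>

definition monotone_mat :: "real mat \<Rightarrow> bool" where
  "monotone_mat A \<longleftrightarrow> square_mat A \<and>
     (\<exists>A'. inverts_mat A A' \<and> inverts_mat A' A \<and> nonneg_mat A')"

text \<open>The library's spectral radius is that of complex matrices. For \<open>0 \<times> 0\<close> matrices it is
  the unspecified maximum of the empty set; this case is irrelevant here.\<close>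

definition m_matrix :: "real mat \<Rightarrow> bool" where
  "m_matrix A \<longleftrightarrow> square_mat A \<and>
     (\<exists>s. \<exists>B \<in> carrier_mat (dim_row A) (dim_row A).
        nonneg_mat B \<and> A = s \<cdot>\<^sub>m 1\<^sub>m (dim_row A) - B \<and>
        spectral_radius (map_mat complex_of_real B) < s)"

text \<open>Points are numbered \<open>1, \<dots>, N\<close>; indices \<open>0\<close> and \<open>N + 1\<close> are reserved for ghost points.\<close>

definition uniform_grid :: "real \<Rightarrow> nat \<Rightarrow> real \<Rightarrow> (nat \<Rightarrow> real) \<Rightarrow> bool" where
  "uniform_grid L N h x \<longleftrightarrow>
     0 < h \<and> x 1 = - L \<and> x N = L \<and> (\<forall>i\<in>{1..<N}. x (i + 1) - x i = h)"

text \<open>Ghost extensions of a grid function given on \<open>{1..N} \<times> {1..N}\<close>. The scheme never refers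
  to the four corner ghosts (nor to tangential ghosts of a velocity component), so the values
  there are immaterial.\<close>

type_synonym grid_fun = "nat \<Rightarrow> nat \<Rightarrow> real"

definition even_ext :: "nat \<Rightarrow> grid_fun \<Rightarrow> grid_fun" where
  "even_ext N w i j =
     (if i = 0 then w 2 j else if i = N + 1 then w (N - 1) j
      else if j = 0 then w i 2 else if j = N + 1 then w i (N - 1) else w i j)"

definition odd_ext_x :: "nat \<Rightarrow> grid_fun \<Rightarrow> grid_fun" where
  "odd_ext_x N w i j =
     (if i = 0 then - w 2 j else if i = N + 1 then - w (N - 1) j else w i j)"

definition odd_ext_y :: "nat \<Rightarrow> grid_fun \<Rightarrow> grid_fun" where
  "odd_ext_y N w i j =
     (if j = 0 then - w i 2 else if j = N + 1 then - w i (N - 1) else w i j)"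

text \<open>Left-hand side of the scheme at \<open>(i, j)\<close>; all four grid functions carry ghost values.\<close>

definition scheme_lhs ::
  "real \<Rightarrow> real \<Rightarrow> real \<Rightarrow> grid_fun \<Rightarrow> grid_fun \<Rightarrow> grid_fun \<Rightarrow> grid_fun \<Rightarrow> grid_fun" where
  "scheme_lhs h dt D M u v g i j =
     M i j * g i j
     + dt * ((u (i-1) j * g (i-1) j - u (i+1) j * g (i+1) j) / (2 * h))
     + dt * ((v i (j-1) * g i (j-1) - v i (j+1) * g i (j+1)) / (2 * h))
     + dt * ((- D * (M (i-1) j + M i j) * g (i-1) j
              + D * (M (i-1) j + 2 * M i j + M (i+1) j) * g i j
              - D * (M i j + M (i+1) j) * g (i+1) j) / (2 * h^2))
     + dt * ((- D * (M i (j-1) + M i j) * g i (j-1)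
              + D * (M i (j-1) + 2 * M i j + M i (j+1)) * g i j
              - D * (M i j + M i (j+1)) * g i (j+1)) / (2 * h^2))"

text \<open>One time step from \<open>g\<close> (time level \<open>n\<close>) to \<open>g'\<close> (time level \<open>n + 1\<close>).\<close>

definition scheme ::
  "nat \<Rightarrow> real \<Rightarrow> real \<Rightarrow> real \<Rightarrow> grid_fun \<Rightarrow> grid_fun \<Rightarrow> grid_fun \<Rightarrow> grid_fun \<Rightarrow> grid_fun \<Rightarrow> bool" where
  "scheme N h dt D M u v g g' \<longleftrightarrow>
     (\<forall>i\<in>{1..N}. \<forall>j\<in>{1..N}. scheme_lhs h dt D M u v (even_ext N g') i j = M i j * g i j)"

text \<open>Unknowns are numbered \<open>0, \<dots>, N\<^sup>2 - 1\<close>, row by row.\<close>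

definition node :: "nat \<Rightarrow> nat \<Rightarrow> nat \<times> nat" where
  "node N p = (p mod N + 1, p div N + 1)"

definition grid_vec :: "nat \<Rightarrow> grid_fun \<Rightarrow> real vec" where
  "grid_vec N w = vec (N * N) (\<lambda>p. w (fst (node N p)) (snd (node N p)))"

definition unit_fun :: "nat \<times> nat \<Rightarrow> grid_fun" where
  "unit_fun c i j = (if (i, j) = c then 1 else 0)"

text \<open>The scheme is linear in the unknown, so column \<open>q\<close> is the left-hand side (with the ghost
  values substituted) evaluated at the \<open>q\<close>-th unit grid function.\<close>

definition coeff_mat ::
  "nat \<Rightarrow> real \<Rightarrow> real \<Rightarrow> real \<Rightarrow> grid_fun \<Rightarrow> grid_fun \<Rightarrow> grid_fun \<Rightarrow> real mat" where
  "coeff_mat N h dt D M u v =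
     mat (N * N) (N * N) (\<lambda>(p, q).
       scheme_lhs h dt D M u v (even_ext N (unit_fun (node N q))) (fst (node N p)) (snd (node N p)))"

lemma node_eq_iff:
  assumes "i \<in> {1..N}" "j \<in> {1..N}" "q < N * N"
  shows "(i, j) = node N q \<longleftrightarrow> q = (i - 1) + N * (j - 1)"
proof
  assume "(i, j) = node N q"
  then show "q = (i - 1) + N * (j - 1)" by (simp add: node_def)
next
  assume q: "q = (i - 1) + N * (j - 1)"
  have "i - 1 < N" using assms by auto
  then have "q mod N = i - 1" "q div N = j - 1" unfolding q by (subst mod_mult_self2 div_mult_self2; simp)+
  then show "(i, j) = node N q" using assms by (simp add: node_def)
qed

lemma node_mem: "p < N * N \<Longrightarrow> fst (node N p) \<in> {1..N} \<and> snd (node N p) \<in> {1..N}"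
  by (cases "N = 0") (auto simp: node_def Suc_le_eq less_mult_imp_div_less)

lemma node_ex:
  assumes "i \<in> {1..N}" "j \<in> {1..N}"
  shows "\<exists>p < N * N. node N p = (i, j)"
proof -
  have lt: "(i - 1) + N * (j - 1) < N * N"
  proof -
    have "(i - 1) + N * (j - 1) < N + N * (j - 1)" using assms by auto
    also have "\<dots> = N * j" using assms by (cases j) auto
    also have "\<dots> \<le> N * N" using assms by auto
    finally show ?thesis .
  qed
  show ?thesis using node_eq_iff[OF assms lt] lt by metis
qed

lemma sum_unit_fun:
  assumes "i \<in> {1..N}" "j \<in> {1..N}"
  shows "(\<Sum>q<N * N. unit_fun (node N q) i j * g (fst (node N q)) (snd (node N q))) = g i j"
proof -
  obtain p where p: "p < N * N" "node N p = (i, j)" using node_ex[OF assms] by auto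
  have eq: "(i, j) = node N q \<longleftrightarrow> q = p" if "q < N * N" for q
    using node_eq_iff[OF assms that] node_eq_iff[OF assms p(1)] p(2) by auto
  have "(\<Sum>q<N * N. unit_fun (node N q) i j * g (fst (node N q)) (snd (node N q)))
      = (\<Sum>q<N * N. if q = p then g i j else 0)"
    by (rule sum.cong) (use eq p in \<open>auto simp: unit_fun_def\<close>)
  then show ?thesis using p by simp
qed

lemma sum_even_ext_unit_fun:
  assumes "N \<ge> 3" "i \<in> {1..N} \<and> j \<le> N + 1 \<or> i \<le> N + 1 \<and> j \<in> {1..N}"
  shows "(\<Sum>q<N * N. even_ext N (unit_fun (node N q)) i j * g (fst (node N q)) (snd (node N q)))
    = even_ext N g i j"
  unfolding even_ext_def using assms by (auto intro!: sum_unit_fun)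

lemma scheme_lhs_sum:
  "scheme_lhs h dt D M u v (\<lambda>i j. \<Sum>q\<in>Q. w q i j * c q) i j
     = (\<Sum>q\<in>Q. scheme_lhs h dt D M u v (w q) i j * c q)"
  unfolding scheme_lhs_def
  by (simp add: sum.distrib sum_subtractf sum_distrib_left sum_distrib_right sum_divide_distrib
      ring_distribs add_divide_distrib diff_divide_distrib sum_negf mult_ac)

lemma coeff_mat_mult_grid_vec:
  assumes "N \<ge> 3"
  shows "coeff_mat N h dt D M u v *\<^sub>v grid_vec N g
    = grid_vec N (scheme_lhs h dt D M u v (even_ext N g))"
proof (rule eq_vecI)
  fix p assume "p < dim_vec (grid_vec N (scheme_lhs h dt D M u v (even_ext N g)))"
  then have p: "p < N * N" by (simp add: grid_vec_def)
  obtain i j where ij: "node N p = (i, j)" by fastforce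
  then have mem: "i \<in> {1..N}" "j \<in> {1..N}" using node_mem[OF p] by auto
  let ?c = "\<lambda>q. g (fst (node N q)) (snd (node N q))"
  let ?e = "\<lambda>i j. \<Sum>q<N * N. even_ext N (unit_fun (node N q)) i j * ?c q"
  have "(coeff_mat N h dt D M u v *\<^sub>v grid_vec N g) $ p
      = (\<Sum>q<N * N. scheme_lhs h dt D M u v (even_ext N (unit_fun (node N q))) i j * ?c q)"
    using p ij by (simp add: coeff_mat_def grid_vec_def scalar_prod_def atLeast0LessThan)
  also have "\<dots> = scheme_lhs h dt D M u v ?e i j"
    by (rule scheme_lhs_sum [symmetric])
  also have "\<dots> = scheme_lhs h dt D M u v (even_ext N g) i j"
  proof -
    have "?e i j = even_ext N g i j" "?e (i-1) j = even_ext N g (i-1) j"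
      "?e (i+1) j = even_ext N g (i+1) j" "?e i (j-1) = even_ext N g i (j-1)"
      "?e i (j+1) = even_ext N g i (j+1)"
      using mem by (intro sum_even_ext_unit_fun[OF assms]; auto)+
    then show ?thesis unfolding scheme_lhs_def by (simp only:)
  qed
  finally show "(coeff_mat N h dt D M u v *\<^sub>v grid_vec N g) $ p
      = grid_vec N (scheme_lhs h dt D M u v (even_ext N g)) $ p"
    using p ij by (simp add: grid_vec_def)
qed (simp add: coeff_mat_def grid_vec_def)

lemma grid_vec_eq_iff:
  "grid_vec N w = grid_vec N w' \<longleftrightarrow> (\<forall>i\<in>{1..N}. \<forall>j\<in>{1..N}. w i j = w' i j)"
proof
  assume eq: "grid_vec N w = grid_vec N w'"
  show "\<forall>i\<in>{1..N}. \<forall>j\<in>{1..N}. w i j = w' i j"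
  proof (intro ballI)
    fix i j assume "i \<in> {1..N}" "j \<in> {1..N}"
    then obtain p where "p < N * N" "node N p = (i, j)" using node_ex by blast
    then show "w i j = w' i j" using arg_cong[OF eq, of "\<lambda>x. x $ p"] by (simp add: grid_vec_def)
  qed
next
  assume "\<forall>i\<in>{1..N}. \<forall>j\<in>{1..N}. w i j = w' i j"
  then show "grid_vec N w = grid_vec N w'"
    using node_mem by (auto simp: grid_vec_def intro!: eq_vecI)
qed

text \<open>The scheme is the linear system with matrix \<^const>\<open>coeff_mat\<close> for the unknown \<open>g'\<close>.\<close>

lemma scheme_iff_linear_system:
  assumes "N \<ge> 3"
  shows "scheme N h dt D M u v g g' \<longleftrightarrow>
    coeff_mat N h dt D M u v *\<^sub>v grid_vec N g' = grid_vec N (\<lambda>i j. M i j * g i j)"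
  using assms by (simp add: coeff_mat_mult_grid_vec grid_vec_eq_iff scheme_def)

end

(* The mesh constraint makes every off-diagonal coefficient nonpositive, ghost terms included.
   The diffusion part annihilates constants, so the row sum of the matrix at (i, j) is exactly the
   left-hand side of the positivity constraint. Hence A is a Z-matrix with positive row sums. Writing
   A = s I - B with B nonnegative, all row sums of B are smaller than s, and so is the spectral radius.
   By the discrete minimum principle A z >= 0 implies z >= 0, which gives injectivity and the sign
   of the inverse. *)

theory Submission
  imports Defs
begin

section \<open>Matrices with nonpositive off-diagonal entries and positive row sums\<close>

text \<open>Take an eigenvector for an eigenvalue of largest modulus and read the eigenvalue
  equation at a component of largest modulus. All other components are dominated by this one, so the
  modulus of the eigenvalue is at most the corresponding row sum.\<close>

lemma spectral_radius_less_row_sum_bound: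
  assumes B: "B \<in> carrier_mat n n" and "0 < n" and "nonneg_mat B"
    and row: "\<And>p. p < n \<Longrightarrow> (\<Sum>q<n. B $$ (p, q)) < s"
  shows "spectral_radius (map_mat complex_of_real B) < s"
proof -
  let ?C = "map_mat complex_of_real B"
  have C: "?C \<in> carrier_mat n n" using B by simp
  obtain k where k: "k \<in> spectrum ?C" "spectral_radius ?C = norm k"
    using spectral_radius_mem_max(1)[OF C \<open>0 < n\<close>] by auto
  then obtain w where "eigenvector ?C w k"
    by (auto simp: spectrum_def eigenvalue_def)
  then have w: "w \<in> carrier_vec n" "w \<noteq> 0\<^sub>v n" "?C *\<^sub>v w = k \<cdot>\<^sub>v w"
    using B by (auto simp: eigenvector_def)
  obtain p where p: "p < n" "\<And>q. q < n \<Longrightarrow> norm (w $ q) \<le> norm (w $ p)"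
  proof -
    have fin: "finite ((\<lambda>q. norm (w $ q)) ` {..<n})" and ne: "(\<lambda>q. norm (w $ q)) ` {..<n} \<noteq> {}"
      using \<open>0 < n\<close> by auto
    from Max_in[OF fin ne] obtain p where "p < n" "Max ((\<lambda>q. norm (w $ q)) ` {..<n}) = norm (w $ p)"
      by auto
    moreover have "norm (w $ q) \<le> Max ((\<lambda>q. norm (w $ q)) ` {..<n})" if "q < n" for q
      using that by (intro Max_ge[OF fin]) auto
    ultimately show thesis by (intro that[of p]) auto
  qed
  \<comment> \<open>This strict positivity keeps the row-sum bound strict and lets the factor be
    cancelled at the end.\<close>
  have "0 < norm (w $ p)"
  proof (rule ccontr)
    assume "\<not> 0 < norm (w $ p)"
    then have "norm (w $ q) \<le> 0" if "q < n" for q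
      using p(2)[OF that] by simp
    then have "w = 0\<^sub>v n" using w(1) by (intro eq_vecI) auto
    with w(2) show False by simp
  qed
  have "k * w $ p = (?C *\<^sub>v w) $ p" using w p by simp
  also have "\<dots> = (\<Sum>q<n. complex_of_real (B $$ (p, q)) * w $ q)"
    using B w(1) p(1) by (simp add: scalar_prod_def atLeast0LessThan)
  finally have "norm k * norm (w $ p) = norm (\<Sum>q<n. complex_of_real (B $$ (p, q)) * w $ q)"
    by (metis norm_mult)
  also have "\<dots> \<le> (\<Sum>q<n. B $$ (p, q) * norm (w $ p))"
  proof (rule sum_norm_le)
    fix q assume "q \<in> {..<n}"
    then show "norm (complex_of_real (B $$ (p, q)) * w $ q) \<le> B $$ (p, q) * norm (w $ p)"
      using p B \<open>nonneg_mat B\<close> by (auto simp: norm_mult nonneg_mat_def intro!: mult_mono)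
  qed
  also have "\<dots> = (\<Sum>q<n. B $$ (p, q)) * norm (w $ p)" by (simp add: sum_distrib_right)
  also have "\<dots> < s * norm (w $ p)" using row[OF p(1)] \<open>0 < norm (w $ p)\<close> by simp
  finally show ?thesis using k(2) \<open>0 < norm (w $ p)\<close> by simp
qed

text \<open>Any shift \<open>s\<close> that dominates the diagonal makes \<open>s I - A\<close>
  nonnegative, and its row sums are \<open>s\<close> minus the positive row sums of
  \<open>A\<close>, hence below \<open>s\<close>.\<close>

lemma m_matrix_if_pos_row_sums:
  assumes A: "A \<in> carrier_mat n n" and "0 < n"
    and off: "\<And>p q. p < n \<Longrightarrow> q < n \<Longrightarrow> p \<noteq> q \<Longrightarrow> A $$ (p, q) \<le> 0"
    and row: "\<And>p. p < n \<Longrightarrow> 0 < (\<Sum>q<n. A $$ (p, q))"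
  shows "m_matrix A"
proof -
  \<comment> \<open>The sum of absolute values dominates every diagonal entry without any
    information on their signs.\<close>
  define s where "s = (\<Sum>p<n. \<bar>A $$ (p, p)\<bar>)"
  define B where "B = s \<cdot>\<^sub>m 1\<^sub>m n - A"
  have B: "B \<in> carrier_mat n n" using A unfolding B_def by (intro minus_carrier_mat)
  have Bij: "B $$ (p, q) = (if p = q then s else 0) - A $$ (p, q)" if "p < n" "q < n" for p q
    using that A by (simp add: B_def)
  have diag: "A $$ (p, p) \<le> s" if "p < n" for p
  proof -
    have "\<bar>A $$ (p, p)\<bar> \<le> s"
      unfolding s_def using that by (intro member_le_sum) auto
    then show ?thesis by simp
  qed
  have nonneg: "nonneg_mat B"
    using B diag off by (auto simp: nonneg_mat_def Bij)
  have "(\<Sum>q<n. B $$ (p, q)) < s" if "p < n" for p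
  proof -
    have "(\<Sum>q<n. B $$ (p, q)) = (\<Sum>q<n. (if p = q then s else 0) - A $$ (p, q))"
      using that by (intro sum.cong) (auto simp: Bij)
    also have "\<dots> = s - (\<Sum>q<n. A $$ (p, q))" using that by (simp add: sum_subtractf)
    finally show ?thesis using row[OF that] by simp
  qed
  then have "spectral_radius (map_mat complex_of_real B) < s"
    by (intro spectral_radius_less_row_sum_bound[OF B \<open>0 < n\<close> nonneg])
  moreover have "A = s \<cdot>\<^sub>m 1\<^sub>m n - B" using A by (intro eq_matI) (auto simp: B_def)
  ultimately show ?thesis using A B nonneg unfolding m_matrix_def by auto
qed

text \<open>Look at an index \<open>p\<close> where \<open>z\<close> is minimal. Replacing every
  \<open>z $ q\<close> by \<open>z $ p\<close> in row \<open>p\<close> can only increase the result,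
  because the off-diagonal entries are nonpositive. So the row sum times \<open>z $ p\<close> is
  nonnegative, and the row sum is positive.\<close>

lemma discrete_minimum_principle:
  fixes A :: "real mat"
  assumes A: "A \<in> carrier_mat n n"
    and off: "\<And>p q. p < n \<Longrightarrow> q < n \<Longrightarrow> p \<noteq> q \<Longrightarrow> A $$ (p, q) \<le> 0"
    and row: "\<And>p. p < n \<Longrightarrow> 0 < (\<Sum>q<n. A $$ (p, q))"
    and z: "z \<in> carrier_vec n" and nonneg: "\<And>p. p < n \<Longrightarrow> 0 \<le> (A *\<^sub>v z) $ p"
    and "r < n"
  shows "0 \<le> z $ r"
proof -
  obtain p where p: "p < n" "\<And>q. q < n \<Longrightarrow> z $ p \<le> z $ q"
  proof -
    have fin: "finite ((\<lambda>q. z $ q) ` {..<n})" and ne: "(\<lambda>q. z $ q) ` {..<n} \<noteq> {}"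
      using \<open>r < n\<close> by auto
    from Min_in[OF fin ne] obtain p where "p < n" "Min ((\<lambda>q. z $ q) ` {..<n}) = z $ p"
      by auto
    moreover have "Min ((\<lambda>q. z $ q) ` {..<n}) \<le> z $ q" if "q < n" for q
      using that by (intro Min_le[OF fin]) auto
    ultimately show thesis by (intro that[of p]) auto
  qed
  have "0 \<le> (\<Sum>q<n. A $$ (p, q) * z $ q)"
    using nonneg[OF p(1)] A z p(1) by (simp add: scalar_prod_def atLeast0LessThan)
  also have "\<dots> \<le> (\<Sum>q<n. A $$ (p, q) * z $ p)"
  proof (rule sum_mono)
    fix q assume "q \<in> {..<n}"
    then show "A $$ (p, q) * z $ q \<le> A $$ (p, q) * z $ p"
      using p off[of p q] by (cases "p = q") (auto intro: mult_left_mono_neg)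
  qed
  also have "\<dots> = (\<Sum>q<n. A $$ (p, q)) * z $ p" by (simp add: sum_distrib_right)
  finally have "0 \<le> z $ p" using row[OF p(1)] by (simp add: zero_le_mult_iff)
  with p(2)[OF \<open>r < n\<close>] show ?thesis by simp
qed

text \<open>The minimum principle for \<open>z\<close> and \<open>-z\<close> makes the kernel
  trivial, so \<open>A\<close> has a two-sided inverse. Its columns are mapped by \<open>A\<close>
  to unit vectors, which are nonnegative, so the minimum principle applies to them too.\<close>

lemma monotone_mat_if_pos_row_sums:
  assumes A: "A \<in> carrier_mat n n"
    and off: "\<And>p q. p < n \<Longrightarrow> q < n \<Longrightarrow> p \<noteq> q \<Longrightarrow> A $$ (p, q) \<le> 0"
    and row: "\<And>p. p < n \<Longrightarrow> 0 < (\<Sum>q<n. A $$ (p, q))"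
  shows "monotone_mat A"
proof -
  have min: "0 \<le> z $ r" if "r < n" "z \<in> carrier_vec n" "\<And>p. p < n \<Longrightarrow> 0 \<le> (A *\<^sub>v z) $ p" for z r
    by (rule discrete_minimum_principle[OF A off row that(2,3,1)])
  have "z = 0\<^sub>v n" if z: "z \<in> carrier_vec n" "A *\<^sub>v z = 0\<^sub>v n" for z
  proof (rule eq_vecI)
    fix r assume "r < dim_vec (0\<^sub>v n :: real vec)"
    then have r: "r < n" by simp
    have "A *\<^sub>v ((- 1) \<cdot>\<^sub>v z) = (- 1) \<cdot>\<^sub>v 0\<^sub>v n"
      using mult_mat_vec[OF A z(1), of "- 1"] z(2) by simp
    then have "0 \<le> ((- 1) \<cdot>\<^sub>v z) $ r" by (intro min[OF r]) (use z(1) in auto)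
    moreover have "0 \<le> z $ r" by (intro min[OF r]) (use z in auto)
    ultimately show "z $ r = 0\<^sub>v n $ r" using z(1) r by simp
  qed (use z in simp)
  then have "det A \<noteq> 0" using det_0_iff_vec_prod_zero[OF A] by auto
  then have "A \<in> Units (ring_mat TYPE(real) n ())" by (rule det_non_zero_imp_unit[OF A])
  then obtain A' where A': "A' \<in> carrier_mat n n" "A * A' = 1\<^sub>m n" "A' * A = 1\<^sub>m n"
    by (auto simp: Units_def ring_mat_def)
  have "0 \<le> A' $$ (p, q)" if pq: "p < n" "q < n" for p q
  proof -
    have "A *\<^sub>v col A' q = unit_vec n q"
      using A A' pq col_mult2[OF A A'(1), of q] by simp
    then have "0 \<le> col A' q $ p" by (intro min[OF pq(1)]) (use A' pq in auto)
    then show ?thesis using A' pq by simp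
  qed
  then show ?thesis
    unfolding monotone_mat_def inverts_mat_def nonneg_mat_def using A A' by auto
qed

section \<open>Signs and row sums of the scheme\<close>

lemma scheme_lhs_const:
  "scheme_lhs h dt D M u v (\<lambda>_ _. 1) i j
     = M i j + dt * ((u (i-1) j - u (i+1) j) / (2 * h)) + dt * ((v i (j-1) - v i (j+1)) / (2 * h))"
proof -
  have "- D * (a + b) * 1 + D * (a + 2 * b + c) * 1 - D * (b + c) * 1 = 0" for a b c :: real
    by (simp add: algebra_simps)
  then show ?thesis by (simp add: scheme_lhs_def)
qed

text \<open>Row sums are the product with the all-ones vector. The constant 1 is its own even ghost
  extension, so boundary rows need no separate treatment.\<close>

lemma coeff_mat_row_sum:
  assumes "3 \<le> N" "p < N * N" "node N p = (i, j)"
  shows "(\<Sum>q<N * N. coeff_mat N h dt D M u v $$ (p, q))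
     = M i j + dt * ((u (i-1) j - u (i+1) j) / (2 * h)) + dt * ((v i (j-1) - v i (j+1)) / (2 * h))"
proof -
  have "even_ext N (\<lambda>_ _. 1) = (\<lambda>_ _. 1)" by (simp add: even_ext_def fun_eq_iff)
  then have "(coeff_mat N h dt D M u v *\<^sub>v grid_vec N (\<lambda>_ _. 1)) $ p
      = scheme_lhs h dt D M u v (\<lambda>_ _. 1) i j"
    unfolding coeff_mat_mult_grid_vec[OF assms(1)] using assms(2,3) by (simp add: grid_vec_def)
  moreover have "(coeff_mat N h dt D M u v *\<^sub>v grid_vec N (\<lambda>_ _. 1)) $ p
      = (\<Sum>q<N * N. coeff_mat N h dt D M u v $$ (p, q))"
    using assms(2) by (simp add: coeff_mat_def grid_vec_def scalar_prod_def atLeast0LessThan)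
  ultimately show ?thesis by (simp only: scheme_lhs_const)
qed

text \<open>This is the contribution of one coordinate direction: \<open>a\<close>,
  \<open>m\<close>, \<open>a'\<close> are the values of \<open>M\<close> at the previous neighbour,
  the centre and the next neighbour, \<open>c\<close> and \<open>c'\<close> the velocities at the
  two neighbours, and the factor 0 is the value of the unknown at the centre. Over the common
  denominator \<open>2 * h^2\<close> transport is weighted by \<open>h\<close>, so diffusion
  dominates it.\<close>

lemma neighbour_coeffs_nonpos:
  fixes h dt D m a c g a' c' g' :: real
  assumes "0 < h" "0 < dt" "0 \<le> g" "0 \<le> g'"
    and "h * \<bar>c\<bar> \<le> D * a" "h * \<bar>c'\<bar> \<le> D * a'" "0 \<le> D * m"
  shows "dt * ((c * g - c' * g') / (2 * h))
    + dt * ((- D * (a + m) * g + D * (a + 2 * m + a') * 0 - D * (m + a') * g') / (2 * h^2)) \<le> 0"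
proof -
  have "h * c \<le> D * (a + m)"
    using assms(1,5,7) mult_left_mono[OF abs_ge_self[of c], of h] unfolding distrib_left by linarith
  moreover have "- (h * c') \<le> D * (m + a')"
    using assms(1,6,7) mult_left_mono[OF abs_ge_minus_self[of c'], of h] unfolding distrib_left by linarith
  ultimately have "(h * c - D * (a + m)) * g + (- (h * c') - D * (m + a')) * g' \<le> 0"
    using assms(3,4) by (intro add_nonpos_nonpos mult_nonpos_nonneg) auto
  moreover have "dt * ((c * g - c' * g') / (2 * h))
    + dt * ((- D * (a + m) * g + D * (a + 2 * m + a') * 0 - D * (m + a') * g') / (2 * h^2))
    = dt * ((h * c - D * (a + m)) * g + (- (h * c') - D * (m + a')) * g') / (2 * h^2)"
    using assms(1) by (simp add: field_simps power2_eq_square)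
  ultimately show ?thesis
    using assms(2) by (simp add: divide_nonpos_nonneg mult_nonneg_nonpos)
qed

text \<open>Stated for a nonnegative \<open>g\<close> vanishing at the centre rather than for a unit
  function: next to the boundary, reflection can put the value 1 on two opposite neighbours at once,
  one of them a ghost.\<close>

lemma scheme_lhs_nonpos:
  assumes h: "0 < h" and dt: "0 < dt"
    and g: "\<And>i j. 0 \<le> g i j" "g i j = 0"
    and c: "h * \<bar>u (i-1) j\<bar> \<le> D * M (i-1) j" "h * \<bar>u (i+1) j\<bar> \<le> D * M (i+1) j"
      "h * \<bar>v i (j-1)\<bar> \<le> D * M i (j-1)" "h * \<bar>v i (j+1)\<bar> \<le> D * M i (j+1)"
    and M: "0 \<le> D * M i j"
  shows "scheme_lhs h dt D M u v g i j \<le> 0"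
  using neighbour_coeffs_nonpos[OF h dt g(1)[of "i-1" j] g(1)[of "i+1" j] c(1,2) M]
    neighbour_coeffs_nonpos[OF h dt g(1)[of i "j-1"] g(1)[of i "j+1"] c(3,4) M]
  unfolding scheme_lhs_def g(2) by linarith

text \<open>Needed because positivity of \<open>Mf\<close> is assumed on the square alone.\<close>

lemma uniform_grid_mem:
  assumes "uniform_grid L N h x" "i \<in> {1..N}"
  shows "x i \<in> {- L..L}"
proof -
  have h: "0 < h" "x 1 = - L" "x N = L" and step: "\<And>i. i \<in> {1..<N} \<Longrightarrow> x (i + 1) - x i = h"
    using assms(1) by (auto simp: uniform_grid_def)
  \<comment> \<open>Nodes are numbered from 1, so \<open>k\<close> counts the steps taken from the
    left end.\<close>
  have x: "x (Suc k) = - L + k * h" if "k < N" for k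
    using that
  proof (induction k)
    case (Suc k)
    with step[of "Suc k"] show ?case by (simp add: algebra_simps)
  qed (use h in simp)
  have "x i = - L + (i - 1) * h" using x[of "i - 1"] assms(2) by (auto simp: of_nat_diff)
  moreover have "L = - L + (N - 1) * h" using x[of "N - 1"] h(3) assms(2) by (auto simp: of_nat_diff)
  moreover have "0 \<le> (i - 1) * h" "(i - 1) * h \<le> (N - 1) * h"
    using assms(2) h(1) by (auto intro!: mult_right_mono mult_nonneg_nonneg)
  ultimately show ?thesis by simp
qed

section \<open>Ghost values and the conclusion\<close>

theorem theorem3p4:
  fixes L h dt D :: real and N :: nat
    and x y :: "nat \<Rightarrow> real"
    and Mf uf vf :: "real \<Rightarrow> real \<Rightarrow> real"
    and M u v :: "nat \<Rightarrow> nat \<Rightarrow> real"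
  assumes "L > 0" and "N \<ge> 3" and "D > 0" and "dt > 0"
    and "uniform_grid L N h x" and "uniform_grid L N h y"
    and "\<forall>a\<in>{-L..L}. \<forall>b\<in>{-L..L}. Mf a b > 0"
    and "\<forall>j\<in>{1..N}. uf (x 1) (y j) = 0 \<and> uf (x N) (y j) = 0"
    and "\<forall>i\<in>{1..N}. vf (x i) (y 1) = 0 \<and> vf (x i) (y N) = 0"
    and "M = even_ext N (\<lambda>i j. Mf (x i) (y j))"
    and "u = odd_ext_x N (\<lambda>i j. uf (x i) (y j))"
    and "v = odd_ext_y N (\<lambda>i j. vf (x i) (y j))"
    and mesh: "\<forall>i\<in>{1..N}. \<forall>j\<in>{1..N}.
      h * \<bar>u i j\<bar> \<le> D * Min {M (i-1) j, M (i+1) j, M i j, M i (j-1), M i (j+1)} \<and>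
      h * \<bar>v i j\<bar> \<le> D * Min {M (i-1) j, M (i+1) j, M i j, M i (j-1), M i (j+1)}"
  shows "((\<forall>i\<in>{1..N}. \<forall>j\<in>{1..N}.
            M i j + dt * ((u (i-1) j - u (i+1) j) / (2 * h))
                  + dt * ((v i (j-1) - v i (j+1)) / (2 * h)) > 0)
          \<longrightarrow> m_matrix (coeff_mat N h dt D M u v) \<and> monotone_mat (coeff_mat N h dt D M u v))
       \<and> ((\<forall>i\<in>{1..N}. \<forall>j\<in>{1..N}.
            (u (i-1) j - u (i+1) j) / (2 * h) + (v i (j-1) - v i (j+1)) / (2 * h) = 0)
          \<longrightarrow> monotone_mat (coeff_mat N h dt D M u v))"
proof -
  let ?A = "coeff_mat N h dt D M u v" and ?n = "N * N"
  let ?R = "\<lambda>i j. M i j + dt * ((u (i-1) j - u (i+1) j) / (2 * h))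
                  + dt * ((v i (j-1) - v i (j+1)) / (2 * h))"
  have h: "0 < h" using assms(5) by (simp add: uniform_grid_def)
  have A: "?A \<in> carrier_mat ?n ?n" by (simp add: coeff_mat_def)
  have Mpos: "0 < M i j" if "i \<in> {1..N}" "j \<in> {1..N}" for i j
    using that uniform_grid_mem[OF assms(5) that(1)] uniform_grid_mem[OF assms(6) that(2)] assms(7)
    by (auto simp: assms(10) even_ext_def)
  \<comment> \<open>The coefficient coupling a node to a neighbour carries the velocity at that
    neighbour, so each velocity is compared with \<open>M\<close> at its own node.\<close>
  have uv: "h * \<bar>u i j\<bar> \<le> D * M i j" "h * \<bar>v i j\<bar> \<le> D * M i j"
    if "i \<in> {1..N}" "j \<in> {1..N}" for i j
  proof -
    let ?m = "Min {M (i-1) j, M (i+1) j, M i j, M i (j-1), M i (j+1)}"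
    have "D * ?m \<le> D * M i j" using \<open>D > 0\<close> by (intro mult_left_mono Min_le) auto
    with mesh that show "h * \<bar>u i j\<bar> \<le> D * M i j" "h * \<bar>v i j\<bar> \<le> D * M i j"
      by (meson order_trans)+
  qed
  (* The bounds persist at ghost points because |u| and M are both reflected evenly. *)
  have u: "h * \<bar>u i j\<bar> \<le> D * M i j" if ij: "i \<le> N + 1" "j \<in> {1..N}" for i j
  proof -
    have "i \<in> {1..N} \<or> i = 0 \<or> i = N + 1" using ij(1) by auto
    then consider "i \<in> {1..N}" | "i = 0" | "i = N + 1" by blast
    then show ?thesis
    proof cases
      case 1
      then show ?thesis using uv that by blast
    next
      case 2
      then have "\<bar>u i j\<bar> = \<bar>u 2 j\<bar>" "M i j = M 2 j"
        using that \<open>N \<ge> 3\<close> by (auto simp: assms(10,11) even_ext_def odd_ext_x_def)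
      then show ?thesis using uv(1)[of 2 j] that \<open>N \<ge> 3\<close> by simp
    next
      case 3
      then have "\<bar>u i j\<bar> = \<bar>u (N - 1) j\<bar>" "M i j = M (N - 1) j"
        using that \<open>N \<ge> 3\<close> by (auto simp: assms(10,11) even_ext_def odd_ext_x_def)
      moreover have "N - 1 \<in> {1..N}" using \<open>N \<ge> 3\<close> by auto
      ultimately show ?thesis using uv(1)[of "N - 1" j] that by simp
    qed
  qed
  have v: "h * \<bar>v i j\<bar> \<le> D * M i j" if ij: "i \<in> {1..N}" "j \<le> N + 1" for i j
  proof -
    have "j \<in> {1..N} \<or> j = 0 \<or> j = N + 1" using ij(2) by auto
    then consider "j \<in> {1..N}" | "j = 0" | "j = N + 1" by blast
    then show ?thesis
    proof cases
      case 1
      then show ?thesis using uv that by blast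
    next
      case 2
      then have "\<bar>v i j\<bar> = \<bar>v i 2\<bar>" "M i j = M i 2"
        using that \<open>N \<ge> 3\<close> by (auto simp: assms(10,12) even_ext_def odd_ext_y_def)
      then show ?thesis using uv(2)[of i 2] that \<open>N \<ge> 3\<close> by simp
    next
      case 3
      then have "\<bar>v i j\<bar> = \<bar>v i (N - 1)\<bar>" "M i j = M i (N - 1)"
        using that \<open>N \<ge> 3\<close> by (auto simp: assms(10,12) even_ext_def odd_ext_y_def)
      moreover have "N - 1 \<in> {1..N}" using \<open>N \<ge> 3\<close> by auto
      ultimately show ?thesis using uv(2)[of i "N - 1"] that by simp
    qed
  qed
  have off: "?A $$ (p, q) \<le> 0" if pq: "p < ?n" "q < ?n" "p \<noteq> q" for p q
  proof -
    obtain i j where ij: "node N p = (i, j)" by fastforce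
    then have mem: "i \<in> {1..N}" "j \<in> {1..N}" using node_mem[OF pq(1)] by auto
    let ?g = "even_ext N (unit_fun (node N q))"
    \<comment> \<open>Injectivity of the numbering: an off-diagonal column belongs to a unit
      function that vanishes at the centre of row \<open>p\<close>.\<close>
    have "(i, j) \<noteq> node N q"
      using node_eq_iff[OF mem pq(1)] node_eq_iff[OF mem pq(2)] ij pq(3) by simp
    then have "?g i j = 0" using mem by (auto simp: even_ext_def unit_fun_def)
    moreover have "0 \<le> ?g i j" for i j by (simp add: even_ext_def unit_fun_def)
    moreover have "0 \<le> D * M i j" using \<open>D > 0\<close> Mpos[OF mem] by simp
    ultimately have "scheme_lhs h dt D M u v ?g i j \<le> 0"
      using mem by (intro scheme_lhs_nonpos h \<open>dt > 0\<close> u v) auto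
    then show ?thesis using pq ij by (simp add: coeff_mat_def)
  qed
  have main: "m_matrix ?A \<and> monotone_mat ?A" if R: "\<forall>i\<in>{1..N}. \<forall>j\<in>{1..N}. 0 < ?R i j"
  proof -
    have row: "0 < (\<Sum>q<?n. ?A $$ (p, q))" if p: "p < ?n" for p
    proof -
      obtain i j where ij: "node N p = (i, j)" by fastforce
      then have "i \<in> {1..N}" "j \<in> {1..N}" using node_mem[OF p] by auto
      then have "0 < ?R i j" using R by blast
      then show ?thesis unfolding coeff_mat_row_sum[OF \<open>N \<ge> 3\<close> p ij] .
    qed
    have "0 < ?n" using \<open>N \<ge> 3\<close> by simp
    from m_matrix_if_pos_row_sums[OF A this off row] monotone_mat_if_pos_row_sums[OF A off row]
    show ?thesis by blast
  qed
  \<comment> \<open>With zero discrete divergence the row sum is just \<open>M i j\<close>, so the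
    positivity constraint holds automatically.\<close>
  moreover have "0 < ?R i j" if "i \<in> {1..N}" "j \<in> {1..N}"
    and "(u (i-1) j - u (i+1) j) / (2 * h) + (v i (j-1) - v i (j+1)) / (2 * h) = 0" for i j
  proof -
    have "?R i j = M i j + dt * ((u (i-1) j - u (i+1) j) / (2 * h) + (v i (j-1) - v i (j+1)) / (2 * h))"
      by (simp only: distrib_left add.assoc)
    then show ?thesis using Mpos[OF that(1,2)] that(3) by simp
  qed
  ultimately show ?thesis by blast
qed

end
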